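(* Let $K$ be a commutative associative domain with identity, and let $\Lambda_2\subset\Lambda_3$, the column $\bar c_3$, its stabilizer $G\le \mathrm{GL}(3,\Lambda_3)$, and the residues $\alpha,\beta,\gamma,\delta\in\Lambda_2$ of a matrix $A\in G$ be as defined in the context. Then the map $$\rho: G\to \mathrm{GL}_2(\Lambda_2),\qquad A\mapsto\begin{pmatrix}1+\beta&\alpha\\ \delta&1+\gamma\end{pmatrix},$$ is a (group) homomorphism.
   Context: Either $\Lambda_k=K[a_1,\dots,a_k]$ (polynomial ring) and $c_i=a_i$, or $\Lambda_k=K[a_1^{\pm1},\dots,a_k^{\pm1}]$ (Laurent polynomial ring) and $c_i=a_i-1$; the same choice is made for $k=2,3$. Let $\bar c_3=(c_1,c_2,c_3)^{T}$ and $G=\{g\in \mathrm{GL}(3,\Lambda_3): g\bar c_3=\bar c_3\}$. Inside the field of fractions of $\Lambda_3$ put $\Lambda_3^{(-)}=\Lambda_3+c_3^{-1}\Lambda_3$. Every element $g$ of $\Lambda_3^{(-)}$ can be written uniquely as $g=g_{-1}c_3^{-1}+g_0+g_1c_3+g_2c_3^2$ with $g_{-1},g_0,g_1\in\Lambda_2$ and $g_2\in\Lambda_3$; this applies entrywise to matrices over $\Lambda_3^{(-)}$. Let $C=\begin{pmatrix}1&0&c_1\\0&1&c_2\\0&0&c_3\end{pmatrix}$. For $A\in G$ the matrix $C^{-1}AC$ has last column $(0,0,1)^{T}$; $R(A)$ denotes its upper-left $2\times2$ block, a matrix over $\Lambda_3^{(-)}$. If $A=E+(a_{ij})$, then $$R(A)=\begin{pmatrix}1+a_{11}-a_{31}c_1c_3^{-1}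 & a_{12}-a_{32}c_1c_3^{-1}\\ a_{21}-a_{31}c_2c_3^{-1} & 1+a_{22}-a_{32}c_2c_3^{-1}\end{pmatrix}.$$ Write $R(A)=E+R_2c_3^2+R_1c_3+R_0+R_{-1}c_3^{-1}$ with $R_1,R_0,R_{-1}\in \mathrm{M}_2(\Lambda_2)$ and $R_2\in \mathrm{M}_2(\Lambda_3)$, where $E$ is the identity matrix. Let $X=\begin{pmatrix}c_1c_2&-c_1^2\\ c_2^2&-c_1c_2\end{pmatrix}$. The residues of $A$ (with respect to $c_3$) are the unique elements $\alpha,\beta,\gamma,\delta\in\Lambda_2$ such that $R_{-1}=\alpha X$, $R_0X=\beta X$, $XR_0=\gamma X$, $XR_1X=\delta X$; such elements exist for every $A\in G$. *)

theory Defs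
  imports
    "HOL-Analysis.Analysis"
    "HOL-Algebra.Group"
    "HOL-Computational_Algebra.Polynomial"
    "HOL-Computational_Algebra.Fraction_Field"
begin

(* Everything lives in one field, the field of fractions of K[a_1][a_2][a_3] (a_1 is the variable
   of the innermost polynomial type).  It is also the field of fractions of the Laurent polynomial
   ring, and all the rings below are subsets of it. *)

type_synonym 'k ratfun = "'k poly poly poly fract"

definition emb :: "'k::idom poly poly poly \<Rightarrow> 'k ratfun" where
  "emb p = Fraction_Field.Fract p 1"

definition a1 :: "'k::idom ratfun" where "a1 = emb [:[:[:0, 1:]:]:]"
definition a2 :: "'k::idom ratfun" where "a2 = emb [:[:0, 1:]:]"
definition a3 :: "'k::idom ratfun" where "a3 = emb [:0, 1:]"

datatype ring_kind = Polynomials | Laurent_Polynomials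

fun Lambda2 :: "ring_kind \<Rightarrow> 'k::idom ratfun set" where
  "Lambda2 Polynomials = range (\<lambda>p. emb [:p:])"
| "Lambda2 Laurent_Polynomials = {emb [:p:] / (a1 ^ m * a2 ^ n) | p m n. True}"

fun Lambda3 :: "ring_kind \<Rightarrow> 'k::idom ratfun set" where
  "Lambda3 Polynomials = range emb"
| "Lambda3 Laurent_Polynomials = {emb p / (a1 ^ m * a2 ^ n * a3 ^ l) | p m n l. True}"

fun shift :: "ring_kind \<Rightarrow> 'k::idom ratfun \<Rightarrow> 'k ratfun" where
  "shift Polynomials a = a"
| "shift Laurent_Polynomials a = a - 1"

definition c1 :: "ring_kind \<Rightarrow> 'k::idom ratfun" where "c1 \<Lambda> = shift \<Lambda> a1"
definition c2 :: "ring_kind \<Rightarrow> 'k::idom ratfun" where "c2 \<Lambda> = shift \<Lambda> a2"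
definition c3 :: "ring_kind \<Rightarrow> 'k::idom ratfun" where "c3 \<Lambda> = shift \<Lambda> a3"

definition cbar3 :: "ring_kind \<Rightarrow> 'k::idom ratfun ^ 3" where
  "cbar3 \<Lambda> = vector [c1 \<Lambda>, c2 \<Lambda>, c3 \<Lambda>]"

(* For a subring S of the field F: square matrices over F with all entries in S.  The size is the
   index type 'n.  The units of this monoid are the matrices having an inverse with entries in S. *)

definition matrix_monoid :: "'f::field set \<Rightarrow> ('f ^ 'n ^ 'n) monoid" where
  "matrix_monoid S = \<lparr>carrier = {M. \<forall>i j. M $ i $ j \<in> S}, monoid.mult = (**), one = mat 1\<rparr>"

definition GL :: "'f::field set \<Rightarrow> ('f ^ 'n ^ 'n) monoid" where
  "GL S = units_of (matrix_monoid S)"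

definition stab :: "ring_kind \<Rightarrow> ('k::idom ratfun ^ 3 ^ 3) monoid" where
  "stab \<Lambda> = (GL (Lambda3 \<Lambda>))
     \<lparr>carrier := {g \<in> carrier (GL (Lambda3 \<Lambda>)). g *v cbar3 \<Lambda> = cbar3 \<Lambda>}\<rparr>"

(* The unique coefficients (g_{-1}, g_0, g_1, g_2) of an element of Lambda_3 + c_3^{-1} Lambda_3;
   only g_2 may involve a_3. *)

definition expansion ::
  "ring_kind \<Rightarrow> 'k::idom ratfun \<Rightarrow> 'k ratfun \<times> 'k ratfun \<times> 'k ratfun \<times> 'k ratfun" where
  "expansion \<Lambda> g = (THE (gm1, g0, g1, g2).
     gm1 \<in> Lambda2 \<Lambda> \<and> g0 \<in> Lambda2 \<Lambda> \<and> g1 \<in> Lambda2 \<Lambda> \<and> g2 \<in> Lambda3 \<Lambda> \<and>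
     g = gm1 * inverse (c3 \<Lambda>) + g0 + g1 * c3 \<Lambda> + g2 * (c3 \<Lambda>)\<^sup>2)"

definition coeff_m1 :: "ring_kind \<Rightarrow> 'k::idom ratfun \<Rightarrow> 'k ratfun" where
  "coeff_m1 \<Lambda> g = (case expansion \<Lambda> g of (gm1, g0, g1, g2) \<Rightarrow> gm1)"

definition coeff_0 :: "ring_kind \<Rightarrow> 'k::idom ratfun \<Rightarrow> 'k ratfun" where
  "coeff_0 \<Lambda> g = (case expansion \<Lambda> g of (gm1, g0, g1, g2) \<Rightarrow> g0)"

definition coeff_1 :: "ring_kind \<Rightarrow> 'k::idom ratfun \<Rightarrow> 'k ratfun" where
  "coeff_1 \<Lambda> g = (case expansion \<Lambda> g of (gm1, g0, g1, g2) \<Rightarrow> g1)"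

definition C_mat :: "ring_kind \<Rightarrow> 'k::idom ratfun ^ 3 ^ 3" where
  "C_mat \<Lambda> = vector [vector [1, 0, c1 \<Lambda>],
                     vector [0, 1, c2 \<Lambda>],
                     vector [0, 0, c3 \<Lambda>]]"

definition upper_left :: "'f::zero ^ 3 ^ 3 \<Rightarrow> 'f ^ 2 ^ 2" where
  "upper_left M = vector [vector [M $ 1 $ 1, M $ 1 $ 2],
                          vector [M $ 2 $ 1, M $ 2 $ 2]]"

definition R_mat :: "ring_kind \<Rightarrow> 'k::idom ratfun ^ 3 ^ 3 \<Rightarrow> 'k ratfun ^ 2 ^ 2" where
  "R_mat \<Lambda> A = upper_left (matrix_inv (C_mat \<Lambda>) ** A ** C_mat \<Lambda>)"

definition R_m1 :: "ring_kind \<Rightarrow> 'k::idom ratfun ^ 3 ^ 3 \<Rightarrow> 'k ratfun ^ 2 ^ 2" where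
  "R_m1 \<Lambda> A = map_matrix (coeff_m1 \<Lambda>) (R_mat \<Lambda> A - mat 1)"

definition R_0 :: "ring_kind \<Rightarrow> 'k::idom ratfun ^ 3 ^ 3 \<Rightarrow> 'k ratfun ^ 2 ^ 2" where
  "R_0 \<Lambda> A = map_matrix (coeff_0 \<Lambda>) (R_mat \<Lambda> A - mat 1)"

definition R_1 :: "ring_kind \<Rightarrow> 'k::idom ratfun ^ 3 ^ 3 \<Rightarrow> 'k ratfun ^ 2 ^ 2" where
  "R_1 \<Lambda> A = map_matrix (coeff_1 \<Lambda>) (R_mat \<Lambda> A - mat 1)"

definition X_mat :: "ring_kind \<Rightarrow> 'k::idom ratfun ^ 2 ^ 2" where
  "X_mat \<Lambda> = vector [vector [c1 \<Lambda> * c2 \<Lambda>, - ((c1 \<Lambda>)\<^sup>2)],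
                     vector [(c2 \<Lambda>)\<^sup>2, - (c1 \<Lambda> * c2 \<Lambda>)]]"

(* Below, map_matrix applied to multiplication by t is the scalar multiple by t. *)

definition res_alpha :: "ring_kind \<Rightarrow> 'k::idom ratfun ^ 3 ^ 3 \<Rightarrow> 'k ratfun" where
  "res_alpha \<Lambda> A = (THE \<alpha>. \<alpha> \<in> Lambda2 \<Lambda> \<and> R_m1 \<Lambda> A = map_matrix ((*) \<alpha>) (X_mat \<Lambda>))"

definition res_beta :: "ring_kind \<Rightarrow> 'k::idom ratfun ^ 3 ^ 3 \<Rightarrow> 'k ratfun" where
  "res_beta \<Lambda> A = (THE \<beta>. \<beta> \<in> Lambda2 \<Lambda> \<and> R_0 \<Lambda> A ** X_mat \<Lambda> = map_matrix ((*) \<beta>) (X_mat \<Lambda>))"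

definition res_gamma :: "ring_kind \<Rightarrow> 'k::idom ratfun ^ 3 ^ 3 \<Rightarrow> 'k ratfun" where
  "res_gamma \<Lambda> A = (THE \<gamma>. \<gamma> \<in> Lambda2 \<Lambda> \<and> X_mat \<Lambda> ** R_0 \<Lambda> A = map_matrix ((*) \<gamma>) (X_mat \<Lambda>))"

definition res_delta :: "ring_kind \<Rightarrow> 'k::idom ratfun ^ 3 ^ 3 \<Rightarrow> 'k ratfun" where
  "res_delta \<Lambda> A = (THE \<delta>. \<delta> \<in> Lambda2 \<Lambda> \<and> X_mat \<Lambda> ** R_1 \<Lambda> A ** X_mat \<Lambda> = map_matrix ((*) \<delta>) (X_mat \<Lambda>))"

definition rho :: "ring_kind \<Rightarrow> 'k::idom ratfun ^ 3 ^ 3 \<Rightarrow> 'k ratfun ^ 2 ^ 2" where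
  "rho \<Lambda> A = vector [vector [1 + res_beta \<Lambda> A, res_alpha \<Lambda> A],
                    vector [res_delta \<Lambda> A, 1 + res_gamma \<Lambda> A]]"

end

theory Submission
  imports Defs
begin

text \<open>
  Write \<open>u = (c\<^sub>1, c\<^sub>2)\<^sup>T\<close> and \<open>v = (c\<^sub>2, -c\<^sub>1)\<close>, so that \<open>X = u v\<close> and \<open>v u = 0\<close>.  Reduction of
  \<open>\<Lambda>\<^sub>3\<close> modulo \<open>c\<^sub>3\<close> is a ring homomorphism onto \<open>\<Lambda>\<^sub>2\<close>; let \<open>A\<^sub>0\<close> be the image of a matrix \<open>A\<close> that fixes
  the column \<open>(c\<^sub>1, c\<^sub>2, c\<^sub>3)\<^sup>T\<close>.  Then \<open>A\<^sub>0\<close> fixes \<open>(c\<^sub>1, c\<^sub>2, 0)\<^sup>T\<close>, and hence, acting on row vectors from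
  the right, it preserves the module of the rows over \<open>\<Lambda>\<^sub>2\<close> that are orthogonal to this column.
  As \<open>c\<^sub>1, c\<^sub>2\<close> is a regular sequence in \<open>\<Lambda>\<^sub>2\<close> (lemma \<open>syzygy_c1_c2\<close>), that module is free with the basis
  \<open>(0, 0, 1)\<close>, \<open>(-c\<^sub>2, c\<^sub>1, 0)\<close>.

  The theorem holds because \<open>\<rho>(A)\<close> is the matrix of this action in this basis: if \<open>P\<close> is the
  2-by-3 matrix of the two basis rows, then \<open>P A\<^sub>0 = \<rho>(A) P\<close> (lemma \<open>frame_reduce\<close>).  Multiplicativity
  follows from \<open>P A\<^sub>0 B\<^sub>0 = \<rho>(A) P B\<^sub>0 = \<rho>(A) \<rho>(B) P\<close> and the independence of the rows of \<open>P\<close>, and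
  invertibility of \<open>\<rho>(A)\<close> follows from multiplicativity applied to \<open>A\<close> and its inverse.

  The work lies in identifying the residues with the entries of that matrix (lemma \<open>residues\<close>).
  With \<open>D = R(A) - E\<close> and \<open>A = (A\<^sub>i\<^sub>j)\<close>, the relations \<open>A c = c\<close> give
  \<open>D u = (A\<^sub>3\<^sub>3 - 1) u - c\<^sub>3 (A\<^sub>1\<^sub>3, A\<^sub>2\<^sub>3)\<^sup>T\<close>, while \<open>v D\<close> is \<open>v\<close> times the upper left block of \<open>A - E\<close>.  So
  both products are free of the pole in \<open>c\<^sub>3\<close>, and comparing coefficients of powers of \<open>c\<^sub>3\<close> yields
  \<open>1 + \<beta>\<close> as the reduction of \<open>A\<^sub>3\<^sub>3\<close>, and \<open>\<delta>\<close> as the reduction of \<open>c\<^sub>1 A\<^sub>2\<^sub>3 - c\<^sub>2 A\<^sub>1\<^sub>3\<close>.  The residues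
  \<open>\<alpha>\<close> and \<open>\<gamma>\<close> are the factors by which the reductions of \<open>(A\<^sub>3\<^sub>1, A\<^sub>3\<^sub>2)\<close> and of \<open>v D\<close>, both
  orthogonal to \<open>u\<close>, are multiples of \<open>-v\<close> and of \<open>v\<close>.
\<close>

section \<open>The rings of polynomials and of Laurent polynomials inside the field of fractions\<close>

lemma emb_add: "emb (p + q) = emb p + emb q"
  and emb_diff: "emb (p - q) = emb p - emb q"
  and emb_minus: "emb (- p) = - emb p"
  and emb_mult: "emb (p * q) = emb p * emb q"
  and emb_0: "emb 0 = 0"
  and emb_1: "emb 1 = 1"
  by (simp_all add: emb_def Zero_fract_def One_fract_def)

lemma emb_power: "emb (p ^ n) = emb p ^ n"
  by (induction n) (simp_all add: emb_1 emb_mult)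

lemma emb_eq_iff: "emb p = emb q \<longleftrightarrow> p = q"
  by (simp add: emb_def eq_fract)

lemma emb_eq_0_iff: "emb p = 0 \<longleftrightarrow> p = 0"
  using emb_eq_iff[of p 0] by (simp add: emb_0)

lemmas emb_hom = emb_add emb_diff emb_minus emb_mult emb_0 emb_1 emb_power

text \<open>The value at which every variable has to be evaluated to make the parameters \<open>c\<^sub>i\<close> vanish.  It is
  polymorphic because this evaluation takes place at every level of the iterated polynomial ring.\<close>

definition centre :: "ring_kind \<Rightarrow> 'a::{zero,one}" where
  "centre \<Lambda> = (case \<Lambda> of Polynomials \<Rightarrow> 0 | Laurent_Polynomials \<Rightarrow> 1)"

definition denom2 :: "'k::idom poly poly" where "denom2 = [:[:0, 1:]:] * [:0, 1:]"
definition denom3 :: "'k::idom poly poly poly" where "denom3 = [:denom2:] * [:0, 1:]"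

lemma const_poly_ring:
  "[:a + b:] = [:a:] + [:b:]" "[:a - b:] = [:a:] - [:b:]" "[:a * b:] = [:a:] * [:b:]"
  for a b :: "'a::comm_ring_1"
  by simp_all

lemma const_poly_power: "[:a ^ n:] = [:a:] ^ n" for a :: "'a::comm_ring_1"
proof (induction n)
  case (Suc n)
  have "[:a ^ Suc n:] = [:a:] * [:a ^ n:]" by (simp add: mult.commute)
  then show ?case by (simp only: Suc power_Suc)
qed (simp add: one_pCons)

lemmas const_poly_hom = const_poly_ring const_poly_power

lemma emb_denom2: "emb [:denom2:] = a1 * a2"
  by (simp only: denom2_def const_poly_hom emb_mult a1_def a2_def)

lemma emb_denom3: "emb denom3 = a1 * a2 * a3"
  by (simp only: denom3_def emb_mult emb_denom2 a3_def)

lemma variables_nonzero [simp]: "a1 \<noteq> (0 :: 'k::idom ratfun)" "a2 \<noteq> (0 :: 'k ratfun)" "a3 \<noteq> (0 :: 'k ratfun)"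
  by (simp_all add: a1_def a2_def a3_def emb_eq_0_iff)

text \<open>With one common exponent for all variables, sums and products of fractions only need the
  exponents to be added, and polynomials are the fractions whose exponent is zero.  This form
  serves both kinds of rings at once.\<close>

lemma Lambda2_iff:
  "x \<in> Lambda2 \<Lambda> \<longleftrightarrow> (\<exists>e p. (\<Lambda> = Polynomials \<longrightarrow> e = 0) \<and> x * (a1 * a2) ^ e = emb [:p:])"
proof (cases \<Lambda>)
  case Polynomials
  then show ?thesis by auto
next
  case Laurent_Polynomials
  have "\<exists>e q. x * (a1 * a2) ^ e = emb [:q:]" if "x = emb [:p:] / (a1 ^ m * a2 ^ n)" for p m n
  proof (intro exI)
    have "x * (a1 * a2) ^ (m + n) = emb [:p:] * a1 ^ n * a2 ^ m"
      using that by (simp add: power_add power_mult_distrib field_simps)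
    also have "\<dots> = emb [:p * [:[:0, 1:]:] ^ n * [:0, 1:] ^ m:]"
      by (simp only: const_poly_hom emb_mult emb_power a1_def a2_def)
    finally show "x * (a1 * a2) ^ (m + n) = emb [:p * [:[:0, 1:]:] ^ n * [:0, 1:] ^ m:]" .
  qed
  moreover have "\<exists>p m n. x = emb [:p:] / (a1 ^ m * a2 ^ n)"
    if "x * (a1 * a2) ^ e = emb [:q:]" for e q
  proof (intro exI)
    show "x = emb [:q:] / (a1 ^ e * a2 ^ e)"
      using that by (simp add: field_simps power_mult_distrib)
  qed
  ultimately show ?thesis using Laurent_Polynomials by auto
qed

lemma Lambda3_iff:
  "x \<in> Lambda3 \<Lambda> \<longleftrightarrow> (\<exists>e p. (\<Lambda> = Polynomials \<longrightarrow> e = 0) \<and> x * (a1 * a2 * a3) ^ e = emb p)"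
proof (cases \<Lambda>)
  case Polynomials
  then show ?thesis by auto
next
  case Laurent_Polynomials
  have "\<exists>e q. x * (a1 * a2 * a3) ^ e = emb q"
    if "x = emb p / (a1 ^ m * a2 ^ n * a3 ^ l)" for p m n l
  proof (intro exI)
    have "x * (a1 * a2 * a3) ^ (m + n + l)
        = emb p * (a1 ^ n * a1 ^ l * a2 ^ m * a2 ^ l * a3 ^ m * a3 ^ n)"
      using that by (simp add: power_add power_mult_distrib field_simps)
    then show "x * (a1 * a2 * a3) ^ (m + n + l)
        = emb (p * ([:[:[:0, 1:]:]:] ^ n * [:[:[:0, 1:]:]:] ^ l * [:[:0, 1:]:] ^ m *
            [:[:0, 1:]:] ^ l * [:0, 1:] ^ m * [:0, 1:] ^ n))"
      by (simp only: emb_mult emb_power a1_def a2_def a3_def)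
  qed
  moreover have "\<exists>p m n l. x = emb p / (a1 ^ m * a2 ^ n * a3 ^ l)"
    if "x * (a1 * a2 * a3) ^ e = emb q" for e q
  proof (intro exI)
    show "x = emb q / (a1 ^ e * a2 ^ e * a3 ^ e)"
      using that by (simp add: field_simps power_mult_distrib)
  qed
  ultimately show ?thesis using Laurent_Polynomials by auto
qed

lemma Lambda2E:
  assumes "x \<in> Lambda2 \<Lambda>"
  obtains e p where "\<Lambda> = Polynomials \<longrightarrow> e = 0" "x * emb [:denom2 ^ e:] = emb [:p:]"
  using assms by (auto simp: Lambda2_iff const_poly_power emb_power emb_denom2)

lemma Lambda3E:
  assumes "x \<in> Lambda3 \<Lambda>"
  obtains e p where "\<Lambda> = Polynomials \<longrightarrow> e = 0" "x * emb (denom3 ^ e) = emb p"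
  using assms by (auto simp: Lambda3_iff emb_power emb_denom3)

lemma Lambda2I:
  assumes "\<Lambda> = Polynomials \<longrightarrow> e = 0" "x * emb [:denom2 ^ e:] = emb [:p:]"
  shows "x \<in> Lambda2 \<Lambda>"
  using assms by (auto simp: Lambda2_iff const_poly_power emb_power emb_denom2)

lemma Lambda3I:
  assumes "\<Lambda> = Polynomials \<longrightarrow> e = 0" "x * emb (denom3 ^ e) = emb p"
  shows "x \<in> Lambda3 \<Lambda>"
  using assms by (auto simp: Lambda3_iff emb_power emb_denom3)

lemma Lambda2_const: "emb [:p:] \<in> Lambda2 \<Lambda>"
  by (rule Lambda2I[of _ 0]) (auto simp: emb_1 simp flip: one_pCons)

lemma Lambda3_const: "emb p \<in> Lambda3 \<Lambda>"
  by (rule Lambda3I[of _ 0]) (auto simp: emb_1)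

definition is_subring :: "'a::comm_ring_1 set \<Rightarrow> bool" where
  "is_subring S \<longleftrightarrow> 0 \<in> S \<and> 1 \<in> S \<and> (\<forall>x\<in>S. \<forall>y\<in>S. x + y \<in> S \<and> x - y \<in> S \<and> x * y \<in> S)"

lemma subring_Lambda2: "is_subring (Lambda2 \<Lambda>)"
proof -
  have "emb [:0:] \<in> Lambda2 \<Lambda>" "emb [:1:] \<in> Lambda2 \<Lambda>"
    by (rule Lambda2_const)+
  moreover have "x + y \<in> Lambda2 \<Lambda> \<and> x - y \<in> Lambda2 \<Lambda> \<and> x * y \<in> Lambda2 \<Lambda>"
    if xy: "x \<in> Lambda2 \<Lambda>" "y \<in> Lambda2 \<Lambda>" for x y
  proof -
    obtain e p where e: "\<Lambda> = Polynomials \<longrightarrow> e = 0" "x * emb [:denom2 ^ e:] = emb [:p:]"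
      using Lambda2E xy(1) by blast
    obtain f q where f: "\<Lambda> = Polynomials \<longrightarrow> f = 0" "y * emb [:denom2 ^ f:] = emb [:q:]"
      using Lambda2E xy(2) by blast
    have d: "emb [:denom2 ^ (e + f):] = emb [:denom2 ^ e:] * emb [:denom2 ^ f:]"
      by (simp only: power_add const_poly_ring emb_mult)
    have "(x + y) * emb [:denom2 ^ (e + f):] = (x * emb [:denom2 ^ e:]) * emb [:denom2 ^ f:]
        + (y * emb [:denom2 ^ f:]) * emb [:denom2 ^ e:]"
      by (simp only: d) algebra
    also have "\<dots> = emb [:p * denom2 ^ f + q * denom2 ^ e:]"
      by (simp only: e f const_poly_ring emb_add emb_mult)
    finally have 1: "(x + y) * emb [:denom2 ^ (e + f):] = emb [:p * denom2 ^ f + q * denom2 ^ e:]" .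
    have "(x - y) * emb [:denom2 ^ (e + f):] = (x * emb [:denom2 ^ e:]) * emb [:denom2 ^ f:]
        - (y * emb [:denom2 ^ f:]) * emb [:denom2 ^ e:]"
      by (simp only: d) algebra
    also have "\<dots> = emb [:p * denom2 ^ f - q * denom2 ^ e:]"
      by (simp only: e f const_poly_ring emb_diff emb_mult)
    finally have 2: "(x - y) * emb [:denom2 ^ (e + f):] = emb [:p * denom2 ^ f - q * denom2 ^ e:]" .
    have "(x * y) * emb [:denom2 ^ (e + f):] = (x * emb [:denom2 ^ e:]) * (y * emb [:denom2 ^ f:])"
      by (simp only: d) algebra
    also have "\<dots> = emb [:p * q:]"
      by (simp only: e f const_poly_ring emb_add emb_mult)
    finally have 3: "(x * y) * emb [:denom2 ^ (e + f):] = emb [:p * q:]" .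
    show ?thesis
      using Lambda2I[OF _ 1] Lambda2I[OF _ 2] Lambda2I[OF _ 3] e(1) f(1) by auto
  qed
  ultimately show ?thesis
    by (auto simp: is_subring_def emb_hom simp flip: one_pCons)
qed

lemma subring_Lambda3: "is_subring (Lambda3 \<Lambda>)"
proof -
  have "emb 0 \<in> Lambda3 \<Lambda>" "emb 1 \<in> Lambda3 \<Lambda>"
    by (rule Lambda3_const)+
  moreover have "x + y \<in> Lambda3 \<Lambda> \<and> x - y \<in> Lambda3 \<Lambda> \<and> x * y \<in> Lambda3 \<Lambda>"
    if xy: "x \<in> Lambda3 \<Lambda>" "y \<in> Lambda3 \<Lambda>" for x y
  proof -
    obtain e p where e: "\<Lambda> = Polynomials \<longrightarrow> e = 0" "x * emb (denom3 ^ e) = emb p"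
      using Lambda3E xy(1) by blast
    obtain f q where f: "\<Lambda> = Polynomials \<longrightarrow> f = 0" "y * emb (denom3 ^ f) = emb q"
      using Lambda3E xy(2) by blast
    have d: "emb (denom3 ^ (e + f)) = emb (denom3 ^ e) * emb (denom3 ^ f)"
      by (simp only: power_add emb_mult)
    have "(x + y) * emb (denom3 ^ (e + f)) = (x * emb (denom3 ^ e)) * emb (denom3 ^ f)
        + (y * emb (denom3 ^ f)) * emb (denom3 ^ e)"
      by (simp only: d) algebra
    then have 1: "(x + y) * emb (denom3 ^ (e + f)) = emb (p * denom3 ^ f + q * denom3 ^ e)"
      by (simp only: e f emb_add emb_mult)
    have "(x - y) * emb (denom3 ^ (e + f)) = (x * emb (denom3 ^ e)) * emb (denom3 ^ f)
        - (y * emb (denom3 ^ f)) * emb (denom3 ^ e)"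
      by (simp only: d) algebra
    then have 2: "(x - y) * emb (denom3 ^ (e + f)) = emb (p * denom3 ^ f - q * denom3 ^ e)"
      by (simp only: e f emb_diff emb_mult)
    have "(x * y) * emb (denom3 ^ (e + f)) = (x * emb (denom3 ^ e)) * (y * emb (denom3 ^ f))"
      by (simp only: d) algebra
    then have 3: "(x * y) * emb (denom3 ^ (e + f)) = emb (p * q)"
      by (simp only: e f emb_mult)
    show ?thesis
      using Lambda3I[OF _ 1] Lambda3I[OF _ 2] Lambda3I[OF _ 3] e(1) f(1) by auto
  qed
  ultimately show ?thesis
    by (auto simp: is_subring_def emb_hom)
qed

lemma Lambda_closed [intro]:
  fixes x y :: "'a::idom ratfun"
  shows "0 \<in> (Lambda2 \<Lambda> :: 'a ratfun set)" "1 \<in> (Lambda2 \<Lambda> :: 'a ratfun set)"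
    "0 \<in> (Lambda3 \<Lambda> :: 'a ratfun set)" "1 \<in> (Lambda3 \<Lambda> :: 'a ratfun set)"
    "x \<in> Lambda2 \<Lambda> \<Longrightarrow> y \<in> Lambda2 \<Lambda> \<Longrightarrow> x + y \<in> Lambda2 \<Lambda>"
    "x \<in> Lambda2 \<Lambda> \<Longrightarrow> y \<in> Lambda2 \<Lambda> \<Longrightarrow> x - y \<in> Lambda2 \<Lambda>"
    "x \<in> Lambda2 \<Lambda> \<Longrightarrow> y \<in> Lambda2 \<Lambda> \<Longrightarrow> x * y \<in> Lambda2 \<Lambda>"
    "x \<in> Lambda3 \<Lambda> \<Longrightarrow> y \<in> Lambda3 \<Lambda> \<Longrightarrow> x + y \<in> Lambda3 \<Lambda>"
    "x \<in> Lambda3 \<Lambda> \<Longrightarrow> y \<in> Lambda3 \<Lambda> \<Longrightarrow> x - y \<in> Lambda3 \<Lambda>"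
    "x \<in> Lambda3 \<Lambda> \<Longrightarrow> y \<in> Lambda3 \<Lambda> \<Longrightarrow> x * y \<in> Lambda3 \<Lambda>"
  using subring_Lambda2[of \<Lambda>, where 'a='a] subring_Lambda3[of \<Lambda>, where 'a='a]
  unfolding is_subring_def by blast+

lemma Lambda_uminus [intro]:
  "x \<in> Lambda2 \<Lambda> \<Longrightarrow> - x \<in> Lambda2 \<Lambda>" "x \<in> Lambda3 \<Lambda> \<Longrightarrow> - x \<in> Lambda3 \<Lambda>"
  using Lambda_closed(6)[of 0 \<Lambda> x] Lambda_closed(9)[of 0 \<Lambda> x] Lambda_closed(1,3) by auto

lemma Lambda2_subset_Lambda3: "x \<in> Lambda2 \<Lambda> \<Longrightarrow> x \<in> Lambda3 \<Lambda>"
proof -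
  assume "x \<in> Lambda2 \<Lambda>"
  then obtain e p where e: "\<Lambda> = Polynomials \<longrightarrow> e = 0" "x * emb [:denom2 ^ e:] = emb [:p:]"
    using Lambda2E by blast
  have "x * emb (denom3 ^ e) = x * emb [:denom2 ^ e:] * emb ([:0, 1:] ^ e)"
    by (simp only: denom3_def power_mult_distrib const_poly_hom emb_mult mult.assoc)
  also have "\<dots> = emb ([:p:] * [:0, 1:] ^ e)"
    by (simp only: e emb_mult)
  finally show ?thesis using Lambda3I e(1) by blast
qed

lemma c_emb:
  "c1 \<Lambda> = emb [:[:[:- centre \<Lambda>, 1:]:]:]"
  "c2 \<Lambda> = emb [:[:- centre \<Lambda>, 1:]:]"
  "c3 \<Lambda> = emb [:- centre \<Lambda>, 1:]"
  by (cases \<Lambda>;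
      simp add: c1_def c2_def c3_def a1_def a2_def a3_def centre_def flip: emb_1 emb_diff;
      simp add: one_pCons)+

lemma c_nonzero [simp]:
  "c1 \<Lambda> \<noteq> (0 :: 'k::idom ratfun)" "c2 \<Lambda> \<noteq> (0 :: 'k ratfun)" "c3 \<Lambda> \<noteq> (0 :: 'k ratfun)"
  by (simp_all add: c_emb emb_eq_0_iff)

lemma c_mem [intro]:
  "c1 \<Lambda> \<in> Lambda2 \<Lambda>" "c2 \<Lambda> \<in> Lambda2 \<Lambda>" "c1 \<Lambda> \<in> Lambda3 \<Lambda>" "c2 \<Lambda> \<in> Lambda3 \<Lambda>" "c3 \<Lambda> \<in> Lambda3 \<Lambda>"
  unfolding c_emb by (rule Lambda2_const Lambda3_const)+

text \<open>For a fraction \<open>p / (a\<^sub>1 a\<^sub>2 a\<^sub>3)\<^sup>e\<close> the summand in \<open>\<Lambda>\<^sub>2\<close> is its value at \<open>c\<^sub>3 = 0\<close>.  The factor \<open>a\<^sub>3\<^sup>e\<close>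
  of the denominator takes the value 1 there: either \<open>e = 0\<close>, or \<open>a\<^sub>3 = 1 + c\<^sub>3\<close>.\<close>

lemma Lambda3_decompose:
  assumes "x \<in> Lambda3 \<Lambda>"
  shows "\<exists>x0\<in>Lambda2 \<Lambda>. \<exists>q\<in>Lambda3 \<Lambda>. x = x0 + c3 \<Lambda> * q"
proof -
  obtain e p where e: "\<Lambda> = Polynomials \<longrightarrow> e = 0" and p: "x * emb (denom3 ^ e) = emb p"
    using Lambda3E assms by blast
  define p0 where "p0 = poly p (centre \<Lambda>)"
  define x0 where "x0 = emb [:p0:] / emb [:denom2 ^ e:]"
  have d2: "emb [:denom2 ^ e:] \<noteq> (0 :: 'a ratfun)"
    by (simp add: emb_eq_0_iff denom2_def)
  have d3: "emb (denom3 ^ e) \<noteq> (0 :: 'a ratfun)"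
    by (simp add: emb_eq_0_iff denom3_def denom2_def)
  \<comment> \<open>The numerator of \<open>x - x0\<close> over the common denominator vanishes at \<open>c\<^sub>3 = 0\<close>.\<close>
  have "poly (p - [:p0:] * [:0, 1:] ^ e) (centre \<Lambda>) = 0"
    using e by (cases \<Lambda>) (auto simp: p0_def centre_def poly_power)
  then obtain t where t: "p - [:p0:] * [:0, 1:] ^ e = [:- centre \<Lambda>, 1:] * t"
    unfolding poly_eq_0_iff_dvd by (rule dvdE)
  define q where "q = emb t / emb (denom3 ^ e)"
  have x0: "x0 * emb [:denom2 ^ e:] = emb [:p0:]"
    using d2 by (simp add: x0_def)
  have q: "q * emb (denom3 ^ e) = emb t"
    using d3 by (simp add: q_def)
  have "x0 * emb (denom3 ^ e) = x0 * emb [:denom2 ^ e:] * emb ([:0, 1:] ^ e)"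
    by (simp only: denom3_def power_mult_distrib const_poly_hom emb_mult mult.assoc)
  also have "\<dots> = emb ([:p0:] * [:0, 1:] ^ e)"
    by (simp only: x0 emb_mult)
  finally have "(x - x0) * emb (denom3 ^ e) = emb ([:- centre \<Lambda>, 1:] * t)"
    by (simp only: left_diff_distrib p flip: t emb_diff)
  also have "\<dots> = c3 \<Lambda> * q * emb (denom3 ^ e)"
    by (simp only: emb_mult c_emb mult.assoc q)
  finally have "x - x0 = c3 \<Lambda> * q"
    using d3 by simp
  then have "x = x0 + c3 \<Lambda> * q" by (simp add: algebra_simps)
  then show ?thesis
    using Lambda2I[OF e x0] Lambda3I[OF e q] by blast
qed

text \<open>Clearing denominators and evaluating at \<open>c\<^sub>3 = 0\<close> kills the right-hand side, but multiplies the
  numerator of \<open>x\<close> only by a nonzero element of a domain.\<close>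

lemma Lambda2_c3_multiple_eq_0:
  assumes "x \<in> Lambda2 \<Lambda>" "q \<in> Lambda3 \<Lambda>" "x = c3 \<Lambda> * q"
  shows "x = 0"
proof -
  obtain e p where e: "x * emb [:denom2 ^ e:] = emb [:p:]"
    using Lambda2E assms(1) by blast
  obtain f r where f: "\<Lambda> = Polynomials \<longrightarrow> f = 0" "q * emb (denom3 ^ f) = emb r"
    using Lambda3E assms(2) by blast
  have "emb ([:p:] * denom3 ^ f) = c3 \<Lambda> * (q * emb (denom3 ^ f)) * emb [:denom2 ^ e:]"
    by (simp only: emb_mult assms(3) ac_simps flip: e)
  also have "\<dots> = emb ([:- centre \<Lambda>, 1:] * r * [:denom2 ^ e:])"
    by (simp only: f emb_mult c_emb)
  finally have "[:p:] * denom3 ^ f = [:- centre \<Lambda>, 1:] * r * [:denom2 ^ e:]"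
    by (simp only: emb_eq_iff)
  then have "poly ([:p:] * denom3 ^ f) (centre \<Lambda>)
      = poly ([:- centre \<Lambda>, 1:] * r * [:denom2 ^ e:]) (centre \<Lambda>)"
    by (rule arg_cong)
  then have "p * (denom2 * centre \<Lambda>) ^ f = 0"
    by (auto simp: denom3_def)
  moreover have "(denom2 * centre \<Lambda>) ^ f \<noteq> (0 :: 'a poly poly)"
    using f(1) by (cases \<Lambda>) (auto simp: centre_def denom2_def)
  ultimately have "p = 0"
    by (simp only: mult_eq_0_iff) blast
  then have "x * emb [:denom2 ^ e:] = 0"
    using e by (simp add: emb_0)
  moreover have "emb [:denom2 ^ e:] \<noteq> (0 :: 'a ratfun)"
    by (simp add: emb_eq_0_iff denom2_def)
  ultimately show ?thesis by simp
qed

text \<open>The elements \<open>c\<^sub>1\<close> and \<open>c\<^sub>2\<close> form a regular sequence: modulo \<open>c\<^sub>2\<close>, which is evaluation of the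
  second variable, \<open>c\<^sub>1\<close> stays a nonzero element of a domain.  So every syzygy of \<open>(c\<^sub>1, c\<^sub>2)\<close> is
  a multiple of the obvious one.\<close>

lemma syzygy_c1_c2:
  assumes "x \<in> Lambda2 \<Lambda>" "y \<in> Lambda2 \<Lambda>" "x * c1 \<Lambda> + y * c2 \<Lambda> = 0"
  shows "\<exists>t\<in>Lambda2 \<Lambda>. x = t * c2 \<Lambda> \<and> y = - t * c1 \<Lambda>"
proof -
  obtain e p where e: "\<Lambda> = Polynomials \<longrightarrow> e = 0" "x * emb [:denom2 ^ e:] = emb [:p:]"
    using Lambda2E assms(1) by blast
  obtain f q where f: "\<Lambda> = Polynomials \<longrightarrow> f = 0" "y * emb [:denom2 ^ f:] = emb [:q:]"
    using Lambda2E assms(2) by blast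
  let ?l1 = "[:[:- centre \<Lambda>, 1:]:] :: 'a poly poly" and ?l2 = "[:- centre \<Lambda>, 1:] :: 'a poly poly"
  have "emb [:p * denom2 ^ f * ?l1 + q * denom2 ^ e * ?l2:]
      = emb [:p:] * emb [:denom2 ^ f:] * c1 \<Lambda> + emb [:q:] * emb [:denom2 ^ e:] * c2 \<Lambda>"
    by (simp only: const_poly_hom emb_hom c_emb)
  also have "\<dots> = (x * c1 \<Lambda> + y * c2 \<Lambda>) * (emb [:denom2 ^ e:] * emb [:denom2 ^ f:])"
    unfolding e(2)[symmetric] f(2)[symmetric] by algebra
  also have "\<dots> = 0" using assms(3) by simp
  finally have "p * denom2 ^ f * ?l1 + q * denom2 ^ e * ?l2 = 0"
    unfolding emb_eq_0_iff by (simp only: pCons_eq_0_iff)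
  then have "poly (p * denom2 ^ f * ?l1 + q * denom2 ^ e * ?l2) (centre \<Lambda>) = 0"
    by (simp only: poly_0)
  moreover have "poly ?l1 (centre \<Lambda>) \<noteq> 0" "poly ?l2 (centre \<Lambda>) = 0"
    by simp_all
  moreover have "poly (denom2 ^ f) (centre \<Lambda>) \<noteq> (0 :: 'a poly)"
    using f(1) by (cases \<Lambda>) (simp_all add: denom2_def centre_def poly_power)
  ultimately have "poly p (centre \<Lambda>) = 0"
    by (simp only: poly_add poly_mult mult_zero_right add_0_right mult_eq_0_iff) blast
  then obtain r where r: "p = ?l2 * r"
    unfolding poly_eq_0_iff_dvd by (rule dvdE)
  have d: "emb [:denom2 ^ e:] \<noteq> (0 :: 'a ratfun)"
    by (simp add: emb_eq_0_iff denom2_def)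
  define t where "t = emb [:r:] / emb [:denom2 ^ e:]"
  have t: "t * emb [:denom2 ^ e:] = emb [:r:]"
    using d by (simp add: t_def)
  have "x * emb [:denom2 ^ e:] = c2 \<Lambda> * emb [:r:]"
    unfolding e(2) r by (simp only: const_poly_hom emb_mult c_emb)
  also have "\<dots> = t * c2 \<Lambda> * emb [:denom2 ^ e:]"
    by (simp add: mult_ac flip: t)
  finally have x: "x = t * c2 \<Lambda>"
    using d by simp
  have "c2 \<Lambda> * (y + t * c1 \<Lambda>) = 0"
    using assms(3) unfolding x by algebra
  then have "y = - t * c1 \<Lambda>"
    using add_eq_0_iff2 by auto
  with x show ?thesis
    using Lambda2I[OF e(1) t] by blast
qed

section \<open>Reduction modulo the third parameter, and the coefficients of an expansion\<close>

lemma Lambda3_decomposition_unique: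
  assumes "x \<in> Lambda2 \<Lambda>" "y \<in> Lambda2 \<Lambda>" "p \<in> Lambda3 \<Lambda>" "q \<in> Lambda3 \<Lambda>"
    and eq: "x + c3 \<Lambda> * p = y + c3 \<Lambda> * q"
  shows "x = y" and "p = q"
proof -
  have "x - y = c3 \<Lambda> * (q - p)"
    using eq by algebra
  moreover have "x - y \<in> Lambda2 \<Lambda>" "q - p \<in> Lambda3 \<Lambda>"
    using assms by auto
  ultimately have "x - y = 0"
    using Lambda2_c3_multiple_eq_0 by metis
  then show "x = y" by simp
  with eq show "p = q" by simp
qed

text \<open>The projection of \<open>\<Lambda>\<^sub>3 = \<Lambda>\<^sub>2 \<oplus> c\<^sub>3 \<Lambda>\<^sub>3\<close> onto the first summand, that is, evaluation at \<open>c\<^sub>3 = 0\<close>.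
  Defined through the decomposition, it does not depend on a choice of denominators, and it is a
  ring homomorphism because \<open>\<Lambda>\<^sub>2\<close> is a subring and \<open>c\<^sub>3 \<Lambda>\<^sub>3\<close> an ideal.\<close>

definition reduce :: "ring_kind \<Rightarrow> 'k::idom ratfun \<Rightarrow> 'k ratfun" where
  "reduce \<Lambda> x = (THE x0. x0 \<in> Lambda2 \<Lambda> \<and> (\<exists>q\<in>Lambda3 \<Lambda>. x = x0 + c3 \<Lambda> * q))"

lemma reduce_eqI:
  assumes "x0 \<in> Lambda2 \<Lambda>" "q \<in> Lambda3 \<Lambda>" "x = x0 + c3 \<Lambda> * q"
  shows "reduce \<Lambda> x = x0"
  unfolding reduce_def
  by (rule the_equality) (use assms Lambda3_decomposition_unique(1) in blast)+

lemma reduceE: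
  assumes "x \<in> Lambda3 \<Lambda>"
  obtains q where "q \<in> Lambda3 \<Lambda>" "x = reduce \<Lambda> x + c3 \<Lambda> * q" "reduce \<Lambda> x \<in> Lambda2 \<Lambda>"
  using Lambda3_decompose[OF assms] reduce_eqI by metis

lemma reduce_mem [intro]: "x \<in> Lambda3 \<Lambda> \<Longrightarrow> reduce \<Lambda> x \<in> Lambda2 \<Lambda>"
  using reduceE by blast

lemma reduce_Lambda2: "x \<in> Lambda2 \<Lambda> \<Longrightarrow> reduce \<Lambda> x = x"
  by (rule reduce_eqI[of _ _ 0]) auto

lemma reduce_c3: "reduce \<Lambda> (c3 \<Lambda>) = 0"
  by (rule reduce_eqI[of _ _ 1]) auto

lemma reduce_add:
  assumes x: "x \<in> Lambda3 \<Lambda>" and y: "y \<in> Lambda3 \<Lambda>"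
  shows "reduce \<Lambda> (x + y) = reduce \<Lambda> x + reduce \<Lambda> y"
proof -
  obtain p where p: "p \<in> Lambda3 \<Lambda>" "x = reduce \<Lambda> x + c3 \<Lambda> * p" by (rule reduceE[OF x])
  obtain q where q: "q \<in> Lambda3 \<Lambda>" "y = reduce \<Lambda> y + c3 \<Lambda> * q" by (rule reduceE[OF y])
  have "x + y = reduce \<Lambda> x + reduce \<Lambda> y + c3 \<Lambda> * (p + q)"
    using p(2) q(2) by algebra
  then show ?thesis
    using x y p(1) q(1) by (intro reduce_eqI) auto
qed

lemma reduce_mult:
  assumes x: "x \<in> Lambda3 \<Lambda>" and y: "y \<in> Lambda3 \<Lambda>"
  shows "reduce \<Lambda> (x * y) = reduce \<Lambda> x * reduce \<Lambda> y"
proof -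
  obtain p where p: "p \<in> Lambda3 \<Lambda>" "x = reduce \<Lambda> x + c3 \<Lambda> * p" by (rule reduceE[OF x])
  obtain q where q: "q \<in> Lambda3 \<Lambda>" "y = reduce \<Lambda> y + c3 \<Lambda> * q" by (rule reduceE[OF y])
  have "x * y = reduce \<Lambda> x * reduce \<Lambda> y + c3 \<Lambda> * (reduce \<Lambda> x * q + p * y)"
    using p(2) q(2) by algebra
  moreover have "reduce \<Lambda> x * q + p * y \<in> Lambda3 \<Lambda>"
    using x y p(1) q(1) Lambda2_subset_Lambda3 by blast
  ultimately show ?thesis
    using x y by (intro reduce_eqI) auto
qed

lemma reduce_uminus: "x \<in> Lambda3 \<Lambda> \<Longrightarrow> reduce \<Lambda> (- x) = - reduce \<Lambda> x"
  using reduce_mult[of "- 1" \<Lambda> x] by (simp add: Lambda_closed Lambda_uminus reduce_Lambda2)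

lemma reduce_diff:
  "x \<in> Lambda3 \<Lambda> \<Longrightarrow> y \<in> Lambda3 \<Lambda> \<Longrightarrow> reduce \<Lambda> (x - y) = reduce \<Lambda> x - reduce \<Lambda> y"
  using reduce_add[of x \<Lambda> "- y"] by (simp add: Lambda_uminus reduce_uminus)

lemmas reduce_hom = reduce_add reduce_diff reduce_uminus reduce_mult reduce_Lambda2 reduce_c3

text \<open>The graph of \<^const>\<open>expansion\<close>, in which its uniqueness can be stated and proved.\<close>

definition expands :: "ring_kind \<Rightarrow> 'k::idom ratfun \<Rightarrow>
    'k ratfun \<Rightarrow> 'k ratfun \<Rightarrow> 'k ratfun \<Rightarrow> 'k ratfun \<Rightarrow> bool" where
  "expands \<Lambda> g gm1 g0 g1 g2 \<longleftrightarrow>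
     gm1 \<in> Lambda2 \<Lambda> \<and> g0 \<in> Lambda2 \<Lambda> \<and> g1 \<in> Lambda2 \<Lambda> \<and> g2 \<in> Lambda3 \<Lambda> \<and>
     g = gm1 * inverse (c3 \<Lambda>) + g0 + g1 * c3 \<Lambda> + g2 * (c3 \<Lambda>)\<^sup>2"

text \<open>Multiplied by \<open>c\<^sub>3\<close> and written in Horner form, an expansion is three nested decompositions along
  \<open>\<Lambda>\<^sub>3 = \<Lambda>\<^sub>2 \<oplus> c\<^sub>3 \<Lambda>\<^sub>3\<close>, each of which is unique.\<close>

lemma expands_unique:
  assumes "expands \<Lambda> g gm1 g0 g1 g2" "expands \<Lambda> g hm1 h0 h1 h2"
  shows "gm1 = hm1 \<and> g0 = h0 \<and> g1 = h1 \<and> g2 = h2"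
proof -
  let ?c = "c3 \<Lambda>"
  have eq: "?c * g = km1 + ?c * (k0 + ?c * (k1 + ?c * k2))"
    if "expands \<Lambda> g km1 k0 k1 k2" for km1 k0 k1 k2
    using that by (simp add: expands_def field_simps power2_eq_square)
  have mem: "k1 + ?c * k2 \<in> Lambda3 \<Lambda>" "k0 + ?c * (k1 + ?c * k2) \<in> Lambda3 \<Lambda>"
    if "expands \<Lambda> g km1 k0 k1 k2" for km1 k0 k1 k2
    using that unfolding expands_def by (blast intro: Lambda2_subset_Lambda3)+
  note m = assms[unfolded expands_def]
  have 1: "gm1 = hm1" "g0 + ?c * (g1 + ?c * g2) = h0 + ?c * (h1 + ?c * h2)"
    using Lambda3_decomposition_unique[of gm1 \<Lambda> hm1] eq[OF assms(1)] eq[OF assms(2)]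
      mem(2)[OF assms(1)] mem(2)[OF assms(2)] m by metis+
  have 2: "g0 = h0" "g1 + ?c * g2 = h1 + ?c * h2"
    using Lambda3_decomposition_unique[OF _ _ _ _ 1(2)] mem(1)[OF assms(1)] mem(1)[OF assms(2)] m
    by blast+
  have 3: "g1 = h1" "g2 = h2"
    using Lambda3_decomposition_unique[OF _ _ _ _ 2(2)] m by blast+
  show ?thesis using 1 2 3 by blast
qed

lemma coeff_eqI:
  assumes "expands \<Lambda> g gm1 g0 g1 g2"
  shows "coeff_m1 \<Lambda> g = gm1" "coeff_0 \<Lambda> g = g0" "coeff_1 \<Lambda> g = g1"
proof -
  have "expansion \<Lambda> g = (gm1, g0, g1, g2)"
    unfolding expansion_def
    by (rule the_equality)
       (use assms expands_unique[OF assms] in \<open>auto simp: expands_def\<close>)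
  then show "coeff_m1 \<Lambda> g = gm1" "coeff_0 \<Lambda> g = g0" "coeff_1 \<Lambda> g = g1"
    by (simp_all add: coeff_m1_def coeff_0_def coeff_1_def)
qed

definition Lambda3_minus :: "ring_kind \<Rightarrow> 'k::idom ratfun set" where
  "Lambda3_minus \<Lambda> = {x + y / c3 \<Lambda> | x y. x \<in> Lambda3 \<Lambda> \<and> y \<in> Lambda3 \<Lambda>}"

lemma expands_shift:
  assumes "y \<in> Lambda3 \<Lambda>"
  obtains g0 g1 g2 where "expands \<Lambda> (y / c3 \<Lambda>) (reduce \<Lambda> y) g0 g1 g2"
proof -
  obtain p where p: "p \<in> Lambda3 \<Lambda>" "y = reduce \<Lambda> y + c3 \<Lambda> * p" by (rule reduceE[OF assms])
  obtain q where q: "q \<in> Lambda3 \<Lambda>" "p = reduce \<Lambda> p + c3 \<Lambda> * q" by (rule reduceE[OF p(1)])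
  obtain r where r: "r \<in> Lambda3 \<Lambda>" "q = reduce \<Lambda> q + c3 \<Lambda> * r" by (rule reduceE[OF q(1)])
  have "y = reduce \<Lambda> y + c3 \<Lambda> * (reduce \<Lambda> p + c3 \<Lambda> * (reduce \<Lambda> q + c3 \<Lambda> * r))"
    using p(2) q(2) r(2) by metis
  then have "expands \<Lambda> (y / c3 \<Lambda>) (reduce \<Lambda> y) (reduce \<Lambda> p) (reduce \<Lambda> q) r"
    using assms p(1) q(1) r(1)
    by (auto simp: expands_def divide_simps power2_eq_square algebra_simps)
  then show ?thesis using that by blast
qed

lemma Lambda3_minus_eq: "Lambda3_minus \<Lambda> = {y / c3 \<Lambda> | y. y \<in> Lambda3 \<Lambda>}"
proof (intro equalityI subsetI)
  fix g assume "g \<in> Lambda3_minus \<Lambda>"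
  then obtain x y where "g = x + y / c3 \<Lambda>" "x \<in> Lambda3 \<Lambda>" "y \<in> Lambda3 \<Lambda>"
    by (auto simp: Lambda3_minus_def)
  then have "g = (x * c3 \<Lambda> + y) / c3 \<Lambda>" "x * c3 \<Lambda> + y \<in> Lambda3 \<Lambda>"
    by (auto simp: field_simps)
  then show "g \<in> {y / c3 \<Lambda> | y. y \<in> Lambda3 \<Lambda>}" by blast
next
  fix g assume "g \<in> {y / c3 \<Lambda> | y. y \<in> Lambda3 \<Lambda>}"
  then obtain y where "g = 0 + y / c3 \<Lambda>" "y \<in> Lambda3 \<Lambda>" by auto
  then show "g \<in> Lambda3_minus \<Lambda>"
    unfolding Lambda3_minus_def using Lambda_closed(3) by blast
qed

lemma expandsE:
  assumes "g \<in> Lambda3_minus \<Lambda>"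
  obtains g2 where "expands \<Lambda> g (coeff_m1 \<Lambda> g) (coeff_0 \<Lambda> g) (coeff_1 \<Lambda> g) g2"
proof -
  obtain y where y: "y \<in> Lambda3 \<Lambda>" "g = y / c3 \<Lambda>"
    using assms by (auto simp: Lambda3_minus_eq)
  obtain g0 g1 g2 where "expands \<Lambda> g (reduce \<Lambda> y) g0 g1 g2"
    using expands_shift[OF y(1)] y(2) by metis
  then show ?thesis
    using that coeff_eqI by metis
qed

lemma coeff_combination:
  assumes f: "f \<in> Lambda3_minus \<Lambda>" and g: "g \<in> Lambda3_minus \<Lambda>"
    and s: "s \<in> Lambda2 \<Lambda>" and t: "t \<in> Lambda2 \<Lambda>"
  shows "coeff_0 \<Lambda> (s * f + t * g) = s * coeff_0 \<Lambda> f + t * coeff_0 \<Lambda> g"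
    and "coeff_1 \<Lambda> (s * f + t * g) = s * coeff_1 \<Lambda> f + t * coeff_1 \<Lambda> g"
proof -
  obtain f2 where f2: "expands \<Lambda> f (coeff_m1 \<Lambda> f) (coeff_0 \<Lambda> f) (coeff_1 \<Lambda> f) f2"
    by (rule expandsE[OF f])
  obtain g2 where g2: "expands \<Lambda> g (coeff_m1 \<Lambda> g) (coeff_0 \<Lambda> g) (coeff_1 \<Lambda> g) g2"
    by (rule expandsE[OF g])
  have "s * f + t * g = (s * coeff_m1 \<Lambda> f + t * coeff_m1 \<Lambda> g) * inverse (c3 \<Lambda>)
      + (s * coeff_0 \<Lambda> f + t * coeff_0 \<Lambda> g) + (s * coeff_1 \<Lambda> f + t * coeff_1 \<Lambda> g) * c3 \<Lambda>
      + (s * f2 + t * g2) * (c3 \<Lambda>)\<^sup>2"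
    using f2 g2 unfolding expands_def by algebra
  moreover have "s * f2 + t * g2 \<in> Lambda3 \<Lambda>"
    using s t f2 g2 Lambda2_subset_Lambda3 unfolding expands_def by blast
  ultimately have "expands \<Lambda> (s * f + t * g) (s * coeff_m1 \<Lambda> f + t * coeff_m1 \<Lambda> g)
      (s * coeff_0 \<Lambda> f + t * coeff_0 \<Lambda> g) (s * coeff_1 \<Lambda> f + t * coeff_1 \<Lambda> g) (s * f2 + t * g2)"
    using s t f2 g2 unfolding expands_def by blast
  then show "coeff_0 \<Lambda> (s * f + t * g) = s * coeff_0 \<Lambda> f + t * coeff_0 \<Lambda> g"
    and "coeff_1 \<Lambda> (s * f + t * g) = s * coeff_1 \<Lambda> f + t * coeff_1 \<Lambda> g"
    by (rule coeff_eqI)+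
qed

text \<open>When all lower terms are known to vanish, a coefficient is a value at \<open>c\<^sub>3 = 0\<close>.  This is how the
  coefficients in the definitions of the residues are computed.\<close>

lemma leading_coeff_reduce:
  assumes "x \<in> Lambda3 \<Lambda>"
  shows "coeff_m1 \<Lambda> (x / c3 \<Lambda>) = reduce \<Lambda> x"
    and "coeff_0 \<Lambda> x = reduce \<Lambda> x"
    and "coeff_1 \<Lambda> (c3 \<Lambda> * x) = reduce \<Lambda> x"
proof -
  show "coeff_m1 \<Lambda> (x / c3 \<Lambda>) = reduce \<Lambda> x"
    using expands_shift[OF assms] coeff_eqI(1) by metis
  obtain p where p: "p \<in> Lambda3 \<Lambda>" "x = reduce \<Lambda> x + c3 \<Lambda> * p" by (rule reduceE[OF assms])
  obtain q where q: "q \<in> Lambda3 \<Lambda>" "p = reduce \<Lambda> p + c3 \<Lambda> * q" by (rule reduceE[OF p(1)])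
  have "x = reduce \<Lambda> x + reduce \<Lambda> p * c3 \<Lambda> + q * (c3 \<Lambda>)\<^sup>2"
    using p(2) q(2) by algebra
  then have "expands \<Lambda> x 0 (reduce \<Lambda> x) (reduce \<Lambda> p) q"
    using assms p(1) q(1) by (auto simp: expands_def)
  then show "coeff_0 \<Lambda> x = reduce \<Lambda> x"
    by (rule coeff_eqI)
  have "c3 \<Lambda> * x = reduce \<Lambda> x * c3 \<Lambda> + p * (c3 \<Lambda>)\<^sup>2"
    using p(2) by algebra
  then have "expands \<Lambda> (c3 \<Lambda> * x) 0 0 (reduce \<Lambda> x) p"
    using assms p(1) by (auto simp: expands_def)
  then show "coeff_1 \<Lambda> (c3 \<Lambda> * x) = reduce \<Lambda> x"
    by (rule coeff_eqI)
qed

section \<open>The residues of a matrix\<close>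

lemma matrix_inv_eqI:
  fixes M :: "'a::field ^ 'n ^ 'n"
  assumes "M ** N = mat 1"
  shows "matrix_inv M = N"
proof -
  have "N ** M = mat 1"
    using assms matrix_left_right_inverse by blast
  then have "M ** matrix_inv M = mat 1 \<and> matrix_inv M ** M = mat 1"
    unfolding matrix_inv_def using assms by (rule_tac someI[of _ N]) blast
  then show ?thesis
    using \<open>N ** M = mat 1\<close> by (metis matrix_mul_assoc matrix_mul_lid matrix_mul_rid)
qed

lemma inverse_C_mat:
  "matrix_inv (C_mat \<Lambda>) = vector [vector [1, 0, - c1 \<Lambda> / c3 \<Lambda>],
     vector [0, 1, - c2 \<Lambda> / c3 \<Lambda>], vector [0, 0, 1 / c3 \<Lambda>]]"
  by (rule matrix_inv_eqI)
     (simp add: C_mat_def vec_eq_iff forall_3 matrix_matrix_mult_def sum_3 mat_def field_simps)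

lemma R_mat_entries:
  "R_mat \<Lambda> A $ 1 $ 1 = A $ 1 $ 1 - c1 \<Lambda> * (A $ 3 $ 1 / c3 \<Lambda>)"
  "R_mat \<Lambda> A $ 1 $ 2 = A $ 1 $ 2 - c1 \<Lambda> * (A $ 3 $ 2 / c3 \<Lambda>)"
  "R_mat \<Lambda> A $ 2 $ 1 = A $ 2 $ 1 - c2 \<Lambda> * (A $ 3 $ 1 / c3 \<Lambda>)"
  "R_mat \<Lambda> A $ 2 $ 2 = A $ 2 $ 2 - c2 \<Lambda> * (A $ 3 $ 2 / c3 \<Lambda>)"
  unfolding R_mat_def inverse_C_mat
  by (simp_all add: upper_left_def C_mat_def matrix_matrix_mult_def sum_3)

definition fixes_cbar3 :: "ring_kind \<Rightarrow> 'k::idom ratfun ^ 3 ^ 3 \<Rightarrow> bool" where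
  "fixes_cbar3 \<Lambda> A \<longleftrightarrow> (\<forall>i j. A $ i $ j \<in> Lambda3 \<Lambda>) \<and> A *v cbar3 \<Lambda> = cbar3 \<Lambda>"

lemma fixes_cbar3_rows:
  assumes "fixes_cbar3 \<Lambda> A"
  shows "A $ 1 $ 1 * c1 \<Lambda> + A $ 1 $ 2 * c2 \<Lambda> + A $ 1 $ 3 * c3 \<Lambda> = c1 \<Lambda>"
    and "A $ 2 $ 1 * c1 \<Lambda> + A $ 2 $ 2 * c2 \<Lambda> + A $ 2 $ 3 * c3 \<Lambda> = c2 \<Lambda>"
    and "A $ 3 $ 1 * c1 \<Lambda> + A $ 3 $ 2 * c2 \<Lambda> + A $ 3 $ 3 * c3 \<Lambda> = c3 \<Lambda>"
  using assms
  by (simp_all add: fixes_cbar3_def cbar3_def vec_eq_iff forall_3 matrix_vector_mult_def sum_3)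

lemma X_multiple_inject:
  "map_matrix ((*) s) (X_mat \<Lambda>) = map_matrix ((*) t) (X_mat \<Lambda>) \<longleftrightarrow> s = t"
proof
  assume "map_matrix ((*) s) (X_mat \<Lambda>) = map_matrix ((*) t) (X_mat \<Lambda>)"
  then have "map_matrix ((*) s) (X_mat \<Lambda>) $ 1 $ 1 = map_matrix ((*) t) (X_mat \<Lambda>) $ 1 $ 1"
    by simp
  then show "s = t" by (simp add: X_mat_def)
qed simp

lemma res_eqI:
  assumes "s \<in> Lambda2 \<Lambda>"
  shows "R_m1 \<Lambda> A = map_matrix ((*) s) (X_mat \<Lambda>) \<Longrightarrow> res_alpha \<Lambda> A = s"
    and "R_0 \<Lambda> A ** X_mat \<Lambda> = map_matrix ((*) s) (X_mat \<Lambda>) \<Longrightarrow> res_beta \<Lambda> A = s"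
    and "X_mat \<Lambda> ** R_0 \<Lambda> A = map_matrix ((*) s) (X_mat \<Lambda>) \<Longrightarrow> res_gamma \<Lambda> A = s"
    and "X_mat \<Lambda> ** R_1 \<Lambda> A ** X_mat \<Lambda> = map_matrix ((*) s) (X_mat \<Lambda>) \<Longrightarrow> res_delta \<Lambda> A = s"
  using assms
  by (auto simp: res_alpha_def res_beta_def res_gamma_def res_delta_def X_multiple_inject
      intro!: the_equality)

text \<open>The rows of \<open>A c = c\<close> at \<open>c\<^sub>3 = 0\<close>: the reduced matrix fixes \<open>(c\<^sub>1, c\<^sub>2, 0)\<^sup>T\<close>.\<close>

lemma reduce_rows:
  assumes "fixes_cbar3 \<Lambda> A"
  shows "reduce \<Lambda> (A $ 1 $ 1) * c1 \<Lambda> + reduce \<Lambda> (A $ 1 $ 2) * c2 \<Lambda> = c1 \<Lambda>"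
    and "reduce \<Lambda> (A $ 2 $ 1) * c1 \<Lambda> + reduce \<Lambda> (A $ 2 $ 2) * c2 \<Lambda> = c2 \<Lambda>"
    and "reduce \<Lambda> (A $ 3 $ 1) * c1 \<Lambda> + reduce \<Lambda> (A $ 3 $ 2) * c2 \<Lambda> = 0"
proof -
  have mem: "A $ i $ j \<in> Lambda3 \<Lambda>" for i j
    using assms by (simp add: fixes_cbar3_def)
  have "reduce \<Lambda> (A $ i $ 1) * c1 \<Lambda> + reduce \<Lambda> (A $ i $ 2) * c2 \<Lambda>
      = reduce \<Lambda> (A $ i $ 1 * c1 \<Lambda> + A $ i $ 2 * c2 \<Lambda> + A $ i $ 3 * c3 \<Lambda>)" for i
    by (simp add: reduce_hom mem c_mem Lambda_closed)
  then show "reduce \<Lambda> (A $ 1 $ 1) * c1 \<Lambda> + reduce \<Lambda> (A $ 1 $ 2) * c2 \<Lambda> = c1 \<Lambda>"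
    and "reduce \<Lambda> (A $ 2 $ 1) * c1 \<Lambda> + reduce \<Lambda> (A $ 2 $ 2) * c2 \<Lambda> = c2 \<Lambda>"
    and "reduce \<Lambda> (A $ 3 $ 1) * c1 \<Lambda> + reduce \<Lambda> (A $ 3 $ 2) * c2 \<Lambda> = 0"
    by (simp_all add: fixes_cbar3_rows[OF assms] reduce_hom c_mem)
qed

lemma Lambda3_minus_memI:
  assumes "x \<in> Lambda3 \<Lambda>" "y \<in> Lambda3 \<Lambda>" "c \<in> Lambda3 \<Lambda>"
  shows "x - c * (y / c3 \<Lambda>) \<in> Lambda3_minus \<Lambda>"
proof -
  have "x - c * (y / c3 \<Lambda>) = x + (- c * y) / c3 \<Lambda>" "- c * y \<in> Lambda3 \<Lambda>"
    using assms by auto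
  then show ?thesis using assms(1) unfolding Lambda3_minus_def by blast
qed

lemma Lambda3_subset_minus: "x \<in> Lambda3 \<Lambda> \<Longrightarrow> x \<in> Lambda3_minus \<Lambda>"
  using Lambda3_minus_memI[of x \<Lambda> 0 0] by (simp add: Lambda_closed)

lemma coeff_m1_pole:
  assumes "x \<in> Lambda3 \<Lambda>" "y \<in> Lambda3 \<Lambda>" "c \<in> Lambda2 \<Lambda>"
  shows "coeff_m1 \<Lambda> (x - c * (y / c3 \<Lambda>)) = - c * reduce \<Lambda> y"
proof -
  have x: "x - c * (y / c3 \<Lambda>) = (x * c3 \<Lambda> - c * y) / c3 \<Lambda>"
    by (simp add: diff_divide_distrib)
  have "x * c3 \<Lambda> - c * y \<in> Lambda3 \<Lambda>"
    using assms Lambda2_subset_Lambda3 by blast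
  then show ?thesis
    unfolding x leading_coeff_reduce(1)[OF \<open>x * c3 \<Lambda> - c * y \<in> _\<close>]
    using assms by (simp add: reduce_hom Lambda_closed c_mem Lambda2_subset_Lambda3)
qed

text \<open>The combinations that multiplication by \<open>X\<close> produces: the first two pair with \<open>(c\<^sub>1, c\<^sub>2)\<close>, the
  last two with \<open>(c\<^sub>2, -c\<^sub>1)\<close>.\<close>

lemma coeff_pairing:
  assumes "f \<in> Lambda3_minus \<Lambda>" "g \<in> Lambda3_minus \<Lambda>"
  shows "c1 \<Lambda> * coeff_0 \<Lambda> f + c2 \<Lambda> * coeff_0 \<Lambda> g = coeff_0 \<Lambda> (c1 \<Lambda> * f + c2 \<Lambda> * g)"
    and "c1 \<Lambda> * coeff_1 \<Lambda> f + c2 \<Lambda> * coeff_1 \<Lambda> g = coeff_1 \<Lambda> (c1 \<Lambda> * f + c2 \<Lambda> * g)"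
    and "c2 \<Lambda> * coeff_0 \<Lambda> f - c1 \<Lambda> * coeff_0 \<Lambda> g = coeff_0 \<Lambda> (c2 \<Lambda> * f - c1 \<Lambda> * g)"
    and "c2 \<Lambda> * coeff_1 \<Lambda> f - c1 \<Lambda> * coeff_1 \<Lambda> g = coeff_1 \<Lambda> (c2 \<Lambda> * f - c1 \<Lambda> * g)"
  using coeff_combination[OF assms, of "c1 \<Lambda>" "c2 \<Lambda>"]
    coeff_combination[OF assms, of "c2 \<Lambda>" "- c1 \<Lambda>"]
  by (simp_all add: c_mem Lambda_uminus)

text \<open>The residues read off from the matrix at \<open>c\<^sub>3 = 0\<close>.  The last six equations say that the rows
  \<open>(0, 0, 1)\<close> and \<open>(-c\<^sub>2, c\<^sub>1, 0)\<close> are mapped to combinations of themselves.  In the proof,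
  \<open>u = (c\<^sub>1, c\<^sub>2)\<^sup>T\<close> and \<open>v = (c\<^sub>2, -c\<^sub>1)\<close>, so that \<open>X = u v\<close>.\<close>

lemma residues:
  fixes A :: "'k::idom ratfun ^ 3 ^ 3"
  assumes "fixes_cbar3 \<Lambda> A"
  shows "res_alpha \<Lambda> A \<in> Lambda2 \<Lambda>" "res_beta \<Lambda> A \<in> Lambda2 \<Lambda>"
        "res_gamma \<Lambda> A \<in> Lambda2 \<Lambda>" "res_delta \<Lambda> A \<in> Lambda2 \<Lambda>"
    and "reduce \<Lambda> (A $ 3 $ 1) = - res_alpha \<Lambda> A * c2 \<Lambda>"
        "reduce \<Lambda> (A $ 3 $ 2) = res_alpha \<Lambda> A * c1 \<Lambda>"
        "reduce \<Lambda> (A $ 3 $ 3) = 1 + res_beta \<Lambda> A"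
    and "c1 \<Lambda> * reduce \<Lambda> (A $ 2 $ 1) - c2 \<Lambda> * reduce \<Lambda> (A $ 1 $ 1) = - ((1 + res_gamma \<Lambda> A) * c2 \<Lambda>)"
        "c1 \<Lambda> * reduce \<Lambda> (A $ 2 $ 2) - c2 \<Lambda> * reduce \<Lambda> (A $ 1 $ 2) = (1 + res_gamma \<Lambda> A) * c1 \<Lambda>"
        "c1 \<Lambda> * reduce \<Lambda> (A $ 2 $ 3) - c2 \<Lambda> * reduce \<Lambda> (A $ 1 $ 3) = res_delta \<Lambda> A"
proof -
  define r where "r i j = reduce \<Lambda> (A $ i $ j)" for i j
  have mem: "A $ i $ j \<in> Lambda3 \<Lambda>" for i j
    using assms by (simp add: fixes_cbar3_def)
  have rmem: "r i j \<in> Lambda2 \<Lambda>" for i j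
    by (simp add: r_def mem reduce_mem)
  define D where "D = R_mat \<Lambda> A - mat 1"
  have D: "D $ 1 $ 1 = (A $ 1 $ 1 - 1) - c1 \<Lambda> * (A $ 3 $ 1 / c3 \<Lambda>)"
    "D $ 1 $ 2 = A $ 1 $ 2 - c1 \<Lambda> * (A $ 3 $ 2 / c3 \<Lambda>)"
    "D $ 2 $ 1 = A $ 2 $ 1 - c2 \<Lambda> * (A $ 3 $ 1 / c3 \<Lambda>)"
    "D $ 2 $ 2 = (A $ 2 $ 2 - 1) - c2 \<Lambda> * (A $ 3 $ 2 / c3 \<Lambda>)"
    by (simp_all add: D_def R_mat_entries mat_def)
  have Dmem: "D $ i $ j \<in> Lambda3_minus \<Lambda>" for i j
    using exhaust_2[of i] exhaust_2[of j]
    by (elim disjE; simp only: D; intro Lambda3_minus_memI mem Lambda_closed c_mem)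
  \<comment> \<open>The product \<open>D u\<close> has no pole: by the third row of \<open>A c = c\<close>, the numerator is divisible by \<open>c\<^sub>3\<close>.\<close>
  define y z where "y = A $ 3 $ 1 / c3 \<Lambda>" and "z = A $ 3 $ 2 / c3 \<Lambda>"
  have yz: "y * c1 \<Lambda> + z * c2 \<Lambda> = 1 - A $ 3 $ 3"
    using fixes_cbar3_rows(3)[OF assms] by (simp add: y_def z_def field_simps)
  have "c1 \<Lambda> * D $ 1 $ 1 + c2 \<Lambda> * D $ 1 $ 2
      = (A $ 1 $ 1 * c1 \<Lambda> + A $ 1 $ 2 * c2 \<Lambda> + A $ 1 $ 3 * c3 \<Lambda>) - c1 \<Lambda>
        - c1 \<Lambda> * (y * c1 \<Lambda> + z * c2 \<Lambda>) - c3 \<Lambda> * A $ 1 $ 3"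
    unfolding D y_def[symmetric] z_def[symmetric] by algebra
  moreover have "c1 \<Lambda> * D $ 2 $ 1 + c2 \<Lambda> * D $ 2 $ 2
      = (A $ 2 $ 1 * c1 \<Lambda> + A $ 2 $ 2 * c2 \<Lambda> + A $ 2 $ 3 * c3 \<Lambda>) - c2 \<Lambda>
        - c2 \<Lambda> * (y * c1 \<Lambda> + z * c2 \<Lambda>) - c3 \<Lambda> * A $ 2 $ 3"
    unfolding D y_def[symmetric] z_def[symmetric] by algebra
  ultimately have Du:
    "c1 \<Lambda> * D $ 1 $ 1 + c2 \<Lambda> * D $ 1 $ 2 = (A $ 3 $ 3 - 1) * c1 \<Lambda> - c3 \<Lambda> * A $ 1 $ 3"
    "c1 \<Lambda> * D $ 2 $ 1 + c2 \<Lambda> * D $ 2 $ 2 = (A $ 3 $ 3 - 1) * c2 \<Lambda> - c3 \<Lambda> * A $ 2 $ 3"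
    unfolding fixes_cbar3_rows[OF assms] yz by (simp_all add: algebra_simps)
  \<comment> \<open>The polar part of \<open>D\<close> is \<open>u\<close> times a row, so \<open>v\<close> annihilates it.\<close>
  have vD: "c2 \<Lambda> * D $ 1 $ 1 - c1 \<Lambda> * D $ 2 $ 1 = c2 \<Lambda> * (A $ 1 $ 1 - 1) - c1 \<Lambda> * A $ 2 $ 1"
    "c2 \<Lambda> * D $ 1 $ 2 - c1 \<Lambda> * D $ 2 $ 2 = c2 \<Lambda> * A $ 1 $ 2 - c1 \<Lambda> * (A $ 2 $ 2 - 1)"
    unfolding D by algebra+
  note rows = reduce_rows[OF assms, folded r_def]
  note R = R_m1_def R_0_def R_1_def D_def[symmetric]

  \<comment> \<open>The residue \<open>\<alpha>\<close>: the polar part is \<open>-u\<close> times the reduction of \<open>(A\<^sub>3\<^sub>1, A\<^sub>3\<^sub>2)\<close>, a multiple of \<open>v\<close>.\<close>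
  obtain t where t: "t \<in> Lambda2 \<Lambda>" "r 3 1 = t * c2 \<Lambda>" "r 3 2 = - t * c1 \<Lambda>"
    using syzygy_c1_c2[OF rmem rmem rows(3)] by blast
  have "coeff_m1 \<Lambda> (D $ 1 $ 1) = - c1 \<Lambda> * r 3 1" "coeff_m1 \<Lambda> (D $ 1 $ 2) = - c1 \<Lambda> * r 3 2"
    "coeff_m1 \<Lambda> (D $ 2 $ 1) = - c2 \<Lambda> * r 3 1" "coeff_m1 \<Lambda> (D $ 2 $ 2) = - c2 \<Lambda> * r 3 2"
    unfolding D r_def by (intro coeff_m1_pole mem Lambda_closed c_mem)+
  then have "R_m1 \<Lambda> A = map_matrix ((*) (- t)) (X_mat \<Lambda>)"
    using t(2,3) by (simp add: R vec_eq_iff forall_2 X_mat_def power2_eq_square)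
  then have \<alpha>: "res_alpha \<Lambda> A = - t"
    by (rule res_eqI(1)[OF Lambda_uminus(1)[OF t(1)]])

  \<comment> \<open>The residue \<open>\<beta>\<close>: the constant coefficient of \<open>D u\<close> is a multiple of \<open>u\<close>.\<close>
  have u0: "c1 \<Lambda> * coeff_0 \<Lambda> (D $ 1 $ 1) + c2 \<Lambda> * coeff_0 \<Lambda> (D $ 1 $ 2) = (r 3 3 - 1) * c1 \<Lambda>"
    "c1 \<Lambda> * coeff_0 \<Lambda> (D $ 2 $ 1) + c2 \<Lambda> * coeff_0 \<Lambda> (D $ 2 $ 2) = (r 3 3 - 1) * c2 \<Lambda>"
    by (simp_all add: coeff_pairing Dmem Du leading_coeff_reduce mem Lambda_closed c_mem
        reduce_hom r_def)
  have "R_0 \<Lambda> A ** X_mat \<Lambda> = map_matrix ((*) (r 3 3 - 1)) (X_mat \<Lambda>)"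
    unfolding R vec_eq_iff forall_2
    by (simp add: X_mat_def matrix_matrix_mult_def sum_2) (use u0 in algebra)
  moreover have \<beta>_mem: "r 3 3 - 1 \<in> Lambda2 \<Lambda>"
    by (intro Lambda_closed rmem)
  ultimately have \<beta>: "res_beta \<Lambda> A = r 3 3 - 1"
    by (intro res_eqI(2))

  \<comment> \<open>The residue \<open>\<gamma>\<close>: the constant coefficient of \<open>v D\<close> is orthogonal to \<open>u\<close>, hence a multiple of \<open>v\<close>.\<close>
  have v0: "c2 \<Lambda> * coeff_0 \<Lambda> (D $ 1 $ 1) - c1 \<Lambda> * coeff_0 \<Lambda> (D $ 2 $ 1)
      = c2 \<Lambda> * (r 1 1 - 1) - c1 \<Lambda> * r 2 1"
    "c2 \<Lambda> * coeff_0 \<Lambda> (D $ 1 $ 2) - c1 \<Lambda> * coeff_0 \<Lambda> (D $ 2 $ 2)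
      = c2 \<Lambda> * r 1 2 - c1 \<Lambda> * (r 2 2 - 1)"
    by (simp_all add: coeff_pairing Dmem vD leading_coeff_reduce mem Lambda_closed c_mem
        reduce_hom r_def)
  have "(c2 \<Lambda> * (r 1 1 - 1) - c1 \<Lambda> * r 2 1) * c1 \<Lambda> + (c2 \<Lambda> * r 1 2 - c1 \<Lambda> * (r 2 2 - 1)) * c2 \<Lambda>
      = c2 \<Lambda> * (r 1 1 * c1 \<Lambda> + r 1 2 * c2 \<Lambda>) - c1 \<Lambda> * (r 2 1 * c1 \<Lambda> + r 2 2 * c2 \<Lambda>)"
    by algebra
  also have "\<dots> = 0"
    by (simp add: rows)
  finally obtain s where s: "s \<in> Lambda2 \<Lambda>" "c2 \<Lambda> * (r 1 1 - 1) - c1 \<Lambda> * r 2 1 = s * c2 \<Lambda>"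
    "c2 \<Lambda> * r 1 2 - c1 \<Lambda> * (r 2 2 - 1) = - s * c1 \<Lambda>"
    using syzygy_c1_c2[of "c2 \<Lambda> * (r 1 1 - 1) - c1 \<Lambda> * r 2 1" \<Lambda>
        "c2 \<Lambda> * r 1 2 - c1 \<Lambda> * (r 2 2 - 1)"] rmem
    by (auto simp: Lambda_closed c_mem)
  have "X_mat \<Lambda> ** R_0 \<Lambda> A = map_matrix ((*) s) (X_mat \<Lambda>)"
    unfolding R vec_eq_iff forall_2
    by (simp add: X_mat_def matrix_matrix_mult_def sum_2) (use v0 s(2,3) in algebra)
  then have \<gamma>: "res_gamma \<Lambda> A = s"
    by (rule res_eqI(3)[OF s(1)])

  \<comment> \<open>The residue \<open>\<delta>\<close>: the multiple of \<open>u\<close> in \<open>D u\<close> cancels in \<open>v D u\<close>, which leaves a multiple of \<open>c\<^sub>3\<close>.\<close>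
  have E: "c1 \<Lambda> * D $ 1 $ 1 + c2 \<Lambda> * D $ 1 $ 2 \<in> Lambda3_minus \<Lambda>"
    "c1 \<Lambda> * D $ 2 $ 1 + c2 \<Lambda> * D $ 2 $ 2 \<in> Lambda3_minus \<Lambda>"
    unfolding Du by (auto intro!: Lambda3_subset_minus mem Lambda_closed c_mem)
  have eq: "c2 \<Lambda> * (c1 \<Lambda> * D $ 1 $ 1 + c2 \<Lambda> * D $ 1 $ 2)
      - c1 \<Lambda> * (c1 \<Lambda> * D $ 2 $ 1 + c2 \<Lambda> * D $ 2 $ 2)
      = c3 \<Lambda> * (c1 \<Lambda> * A $ 2 $ 3 - c2 \<Lambda> * A $ 1 $ 3)"
    unfolding Du by algebra
  define d where "d = c1 \<Lambda> * r 2 3 - c2 \<Lambda> * r 1 3"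
  have d: "c2 \<Lambda> * (c1 \<Lambda> * coeff_1 \<Lambda> (D $ 1 $ 1) + c2 \<Lambda> * coeff_1 \<Lambda> (D $ 1 $ 2))
      - c1 \<Lambda> * (c1 \<Lambda> * coeff_1 \<Lambda> (D $ 2 $ 1) + c2 \<Lambda> * coeff_1 \<Lambda> (D $ 2 $ 2)) = d"
    unfolding coeff_pairing(2)[OF Dmem Dmem] coeff_pairing(4)[OF E] eq
    by (simp add: leading_coeff_reduce mem Lambda_closed c_mem reduce_hom r_def d_def)
  have "X_mat \<Lambda> ** R_1 \<Lambda> A ** X_mat \<Lambda> = map_matrix ((*) d) (X_mat \<Lambda>)"
    unfolding R vec_eq_iff forall_2
    by (simp add: X_mat_def matrix_matrix_mult_def sum_2 algebra_simps power2_eq_square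
        flip: d)
  moreover have \<delta>_mem: "d \<in> Lambda2 \<Lambda>"
    unfolding d_def by (intro Lambda_closed rmem c_mem)
  ultimately have \<delta>: "res_delta \<Lambda> A = d"
    by (intro res_eqI(4))

  show "res_alpha \<Lambda> A \<in> Lambda2 \<Lambda>" "res_beta \<Lambda> A \<in> Lambda2 \<Lambda>"
        "res_gamma \<Lambda> A \<in> Lambda2 \<Lambda>" "res_delta \<Lambda> A \<in> Lambda2 \<Lambda>"
    unfolding \<alpha> \<beta> \<gamma> \<delta> using t(1) \<beta>_mem s(1) \<delta>_mem by auto
  show "reduce \<Lambda> (A $ 3 $ 1) = - res_alpha \<Lambda> A * c2 \<Lambda>"
        "reduce \<Lambda> (A $ 3 $ 2) = res_alpha \<Lambda> A * c1 \<Lambda>"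
        "reduce \<Lambda> (A $ 3 $ 3) = 1 + res_beta \<Lambda> A"
    using t(2,3) by (simp_all add: \<alpha> \<beta> r_def)
  show "c1 \<Lambda> * reduce \<Lambda> (A $ 2 $ 1) - c2 \<Lambda> * reduce \<Lambda> (A $ 1 $ 1) = - ((1 + res_gamma \<Lambda> A) * c2 \<Lambda>)"
    "c1 \<Lambda> * reduce \<Lambda> (A $ 2 $ 2) - c2 \<Lambda> * reduce \<Lambda> (A $ 1 $ 2) = (1 + res_gamma \<Lambda> A) * c1 \<Lambda>"
    using s(2,3) unfolding \<gamma> r_def by algebra+
  show "c1 \<Lambda> * reduce \<Lambda> (A $ 2 $ 3) - c2 \<Lambda> * reduce \<Lambda> (A $ 1 $ 3) = res_delta \<Lambda> A"
    by (simp add: \<delta> d_def r_def)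
qed

section \<open>The residue matrix as an action on row vectors\<close>

text \<open>The rows are a basis of the rows over \<open>\<Lambda>\<^sub>2\<close> orthogonal to \<open>(c\<^sub>1, c\<^sub>2, 0)\<^sup>T\<close>; the sign of the second row is the
  one for which the residues appear in \<^const>\<open>rho\<close> without signs.\<close>

definition frame :: "ring_kind \<Rightarrow> 'k::idom ratfun ^ 3 ^ 2" where
  "frame \<Lambda> = vector [vector [0, 0, 1], vector [- c2 \<Lambda>, c1 \<Lambda>, 0]]"

lemma frame_reduce:
  assumes "fixes_cbar3 \<Lambda> A"
  shows "frame \<Lambda> ** map_matrix (reduce \<Lambda>) A = rho \<Lambda> A ** frame \<Lambda>"
  using residues(5-)[OF assms]
  by (simp add: vec_eq_iff forall_2 forall_3 frame_def rho_def matrix_matrix_mult_def sum_2 sum_3)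

lemma frame_cancel:
  fixes M N :: "'k::idom ratfun ^ 2 ^ 2"
  assumes "M ** frame \<Lambda> = N ** frame \<Lambda>"
  shows "M = N"
  using assms
  by (simp add: vec_eq_iff forall_2 forall_3 frame_def matrix_matrix_mult_def sum_2)

lemma reduce_matrix_mult:
  fixes A B :: "'k::idom ratfun ^ 'n ^ 'n"
  assumes "\<And>i j. A $ i $ j \<in> Lambda3 \<Lambda>" "\<And>i j. B $ i $ j \<in> Lambda3 \<Lambda>"
  shows "map_matrix (reduce \<Lambda>) (A ** B) = map_matrix (reduce \<Lambda>) A ** map_matrix (reduce \<Lambda>) B"
proof -
  have "reduce \<Lambda> (\<Sum>k\<in>S. A $ i $ k * B $ k $ j) =
      (\<Sum>k\<in>S. reduce \<Lambda> (A $ i $ k) * reduce \<Lambda> (B $ k $ j)) \<and>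
      (\<Sum>k\<in>S. A $ i $ k * B $ k $ j) \<in> Lambda3 \<Lambda>" if "finite S" for S i j
    using that
    by induction (simp_all add: assms reduce_hom Lambda_closed)
  then show ?thesis
    by (simp add: vec_eq_iff matrix_matrix_mult_def)
qed

lemma rho_mult:
  assumes A: "fixes_cbar3 \<Lambda> A" and B: "fixes_cbar3 \<Lambda> B" and AB: "fixes_cbar3 \<Lambda> (A ** B)"
  shows "rho \<Lambda> (A ** B) = rho \<Lambda> A ** rho \<Lambda> B"
proof (rule frame_cancel)
  let ?r = "map_matrix (reduce \<Lambda>)"
  have "rho \<Lambda> (A ** B) ** frame \<Lambda> = frame \<Lambda> ** (?r A ** ?r B)"
    using A B by (simp add: frame_reduce[OF AB, symmetric] reduce_matrix_mult fixes_cbar3_def)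
  also have "\<dots> = rho \<Lambda> A ** (frame \<Lambda> ** ?r B)"
    by (simp add: matrix_mul_assoc frame_reduce[OF A])
  also have "\<dots> = rho \<Lambda> A ** rho \<Lambda> B ** frame \<Lambda>"
    by (simp add: matrix_mul_assoc frame_reduce[OF B])
  finally show "rho \<Lambda> (A ** B) ** frame \<Lambda> = rho \<Lambda> A ** rho \<Lambda> B ** frame \<Lambda>" .
qed

lemma fixes_cbar3_one: "fixes_cbar3 \<Lambda> (mat 1)"
  by (auto simp: fixes_cbar3_def mat_def[of 1] vec_eq_iff matrix_vector_mult_def
      if_distrib[of "\<lambda>x. x * _"] cong: if_cong)

lemma rho_one: "rho \<Lambda> (mat 1) = (mat 1 :: 'k::idom ratfun ^ 2 ^ 2)"
proof (rule frame_cancel)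
  have "map_matrix (reduce \<Lambda>) (mat 1) = (mat 1 :: 'k ratfun ^ 3 ^ 3)"
    by (simp add: vec_eq_iff mat_def reduce_Lambda2 Lambda_closed)
  then show "rho \<Lambda> (mat 1) ** frame \<Lambda> = (mat 1 :: 'k ratfun ^ 2 ^ 2) ** frame \<Lambda>"
    by (simp add: frame_reduce[OF fixes_cbar3_one, symmetric])
qed

lemma rho_entries:
  "fixes_cbar3 \<Lambda> A \<Longrightarrow> rho \<Lambda> A $ i $ j \<in> Lambda2 \<Lambda>"
  using exhaust_2[of i] exhaust_2[of j] residues(1-4)[of \<Lambda> A]
  by (auto simp: rho_def Lambda_closed)

section \<open>The homomorphism\<close>

lemma monoid_matrix_monoid:
  fixes S :: "'f::field set"
  assumes "is_subring S"
  shows "monoid (matrix_monoid S :: ('f ^ 'n ^ 'n) monoid)"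
proof -
  have sum: "(\<Sum>k\<in>T. f k) \<in> S" if "finite T" "\<And>k. f k \<in> S" for f :: "'n \<Rightarrow> 'f" and T
    using that assms by induction (auto simp: is_subring_def)
  show ?thesis
  proof (rule monoidI)
    fix M N :: "'f ^ 'n ^ 'n"
    assume "M \<in> carrier (matrix_monoid S :: ('f ^ 'n ^ 'n) monoid)" "N \<in> carrier (matrix_monoid S)"
    then show "M \<otimes>\<^bsub>matrix_monoid S\<^esub> N \<in> carrier (matrix_monoid S)"
      using assms
      by (auto simp: matrix_monoid_def matrix_matrix_mult_def is_subring_def intro!: sum)
  qed (use assms in \<open>simp_all add: matrix_monoid_def matrix_mul_assoc, simp add: is_subring_def mat_def\<close>)
qed

lemma group_GL: "is_subring S \<Longrightarrow> group (GL S :: ('f::field ^ 'n ^ 'n) monoid)"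
  unfolding GL_def by (rule monoid.units_group[OF monoid_matrix_monoid])

lemma carrier_GL:
  "M \<in> carrier (GL S) \<longleftrightarrow> (\<forall>i j. M $ i $ j \<in> S) \<and>
     (\<exists>N. (\<forall>i j. N $ i $ j \<in> S) \<and> N ** M = mat 1 \<and> M ** N = mat 1)"
  by (auto simp: GL_def units_of_carrier Units_def matrix_monoid_def)

lemma GL_mult: "M \<otimes>\<^bsub>GL S\<^esub> N = M ** N" and GL_one: "\<one>\<^bsub>GL S\<^esub> = mat 1"
  by (simp_all add: GL_def units_of_mult units_of_one matrix_monoid_def)

lemma stab_subgroup:
  "subgroup {g \<in> carrier (GL (Lambda3 \<Lambda>)). g *v cbar3 \<Lambda> = cbar3 \<Lambda>}
     (GL (Lambda3 \<Lambda>) :: ('k::idom ratfun ^ 3 ^ 3) monoid)"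
proof -
  interpret G: group "GL (Lambda3 \<Lambda>) :: ('k ratfun ^ 3 ^ 3) monoid"
    by (rule group_GL[OF subring_Lambda3])
  show ?thesis
  proof (rule G.subgroupI, goal_cases)
    case 2
    have "(mat 1 :: 'k ratfun ^ 3 ^ 3) *v cbar3 \<Lambda> = cbar3 \<Lambda>"
      using fixes_cbar3_one by (simp add: fixes_cbar3_def)
    then show ?case
      using G.one_closed unfolding GL_one by blast
  next
    case (3 g)
    then have "inv\<^bsub>GL (Lambda3 \<Lambda>)\<^esub> g ** g = mat 1"
      using G.l_inv[of g] unfolding GL_mult GL_one by simp
    then have "inv\<^bsub>GL (Lambda3 \<Lambda>)\<^esub> g *v cbar3 \<Lambda> = cbar3 \<Lambda>"
      using 3 by (metis (mono_tags, lifting) matrix_vector_mul_assoc matrix_vector_mul_lid mem_Collect_eq)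
    then show ?case using 3 by simp
  next
    case (4 g h)
    then show ?case
      using G.m_closed[of g h] by (simp add: GL_mult flip: matrix_vector_mul_assoc)
  qed auto
qed

lemma stab_fixes: "A \<in> carrier (stab \<Lambda>) \<Longrightarrow> fixes_cbar3 \<Lambda> A"
  by (simp add: stab_def fixes_cbar3_def carrier_GL)

theorem theorem4:
  fixes \<Lambda> :: ring_kind
  shows "group_hom (stab \<Lambda> :: ('k::idom ratfun ^ 3 ^ 3) monoid)
           (GL (Lambda2 \<Lambda>) :: ('k ratfun ^ 2 ^ 2) monoid) (rho \<Lambda>)"
proof -
  let ?G = "stab \<Lambda> :: ('k ratfun ^ 3 ^ 3) monoid"
  let ?H = "GL (Lambda2 \<Lambda>) :: ('k ratfun ^ 2 ^ 2) monoid"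
  interpret G: group ?G
    unfolding stab_def by (rule subgroup.subgroup_is_group[OF stab_subgroup group_GL[OF subring_Lambda3]])
  interpret H: group ?H
    by (rule group_GL[OF subring_Lambda2])
  have G_mult: "A \<otimes>\<^bsub>?G\<^esub> B = A ** B" and G_one: "\<one>\<^bsub>?G\<^esub> = mat 1" for A B
    by (simp_all add: stab_def GL_mult GL_one)
  have mult: "rho \<Lambda> (A ** B) = rho \<Lambda> A ** rho \<Lambda> B"
    if "A \<in> carrier ?G" "B \<in> carrier ?G" for A B
    using that G.m_closed[of A B] unfolding G_mult by (intro rho_mult stab_fixes)
  have "rho \<Lambda> A \<in> carrier ?H" if A: "A \<in> carrier ?G" for A
  proof -
    let ?B = "inv\<^bsub>?G\<^esub> A"
    have B: "?B \<in> carrier ?G" and "?B ** A = mat 1" "A ** ?B = mat 1"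
      using G.inv_closed[OF A] G.l_inv[OF A] G.r_inv[OF A] by (simp_all add: G_mult G_one)
    then have "rho \<Lambda> ?B ** rho \<Lambda> A = mat 1" "rho \<Lambda> A ** rho \<Lambda> ?B = mat 1"
      using mult[OF A B] mult[OF B A] by (simp_all add: rho_one)
    then show ?thesis
      unfolding carrier_GL using rho_entries[OF stab_fixes] A B by blast
  qed
  then have "rho \<Lambda> \<in> hom ?G ?H"
    using mult by (intro homI) (simp_all add: G_mult GL_mult)
  then show ?thesis
    by (intro group_hom.intro group_hom_axioms.intro G.group_axioms H.group_axioms)
qed

end
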